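(* If $\mathrm{st}$ is a statistic that is shuffle-compatible on words, then the shuffle algebra $\mathcal{A}^{W}_{\mathrm{st}}$ is a quotient algebra of $\mathrm{WQSym}^*$, i.e. isomorphic as a $\mathbb{Q}$-algebra to $\mathrm{WQSym}^*/I$ for some two-sided ideal $I$.
   Context: All algebras are over $\mathbb{Q}$. A word of length $n\ge0$ is a sequence $\alpha=(\alpha_1,\dots,\alpha_n)$ of positive integers; $|\alpha|=n$; $W$ is the set of all words. If the distinct letters of $\alpha$ are $a_1<\dots<a_k$, then $\mathrm{pack}(\alpha)$ is obtained by replacing each $a_i$ by $i$; $\alpha$ is packed if $\mathrm{pack}(\alpha)=\alpha$. A statistic on words is a function on $W$. Two words are disjoint if they have no common letter. $\mathrm{Sh}(\alpha,\beta)$ is the multiset of all $\binom{|\alpha|+|\beta|}{|\alpha|}$ interleavings (shuffles) of $\alpha$ and $\beta$. $\mathrm{st}$ is shuffle-compatible on words if (i) for all disjoint words $\alpha,\beta$ the multiset $\{\{\mathrm{st}(\gamma):\gamma\in \mathrm{Sh}(\alpha,\beta)\}\}$ is determined by $|\alpha|,|\beta|,\mathrm{st}(\alpha),\mathrm{st}(\beta)$; and (ii) $\mathrm{pack}(\alpha)=\mathrm{pack}(\beta)$ implies $\mathrm{st}(\alpha)=\mathrm{st}(\beta)$ for all words $\alpha,\beta$. Let $[\alpha]^W_{\mathrm{st}}=\{\beta\in W:\mathrm{st}(\beta)=\mathrm{st}(\alpha),|\beta|=|\alpha|\}$. $\mathcal{A}^W_{\mathrm{st}}$ is the algebra with basis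 the set of these classes and product $[\alpha]^W_{\mathrm{st}}[\beta]^W_{\mathrm{st}}=\sum_{\gamma\in \mathrm{Sh}(\alpha,\beta)}[\gamma]^W_{\mathrm{st}}$, where $\alpha,\beta$ are disjoint representatives of the two classes. $\mathrm{WQSym}^*$ is the algebra with basis $\{M^*_\alpha\}$ indexed by packed words $\alpha$, and product $M^*_\alpha M^*_\beta=\sum_{\gamma\in \overrightarrow{\mathrm{Sh}}(\alpha,\beta)}M^*_\gamma$, where $\overrightarrow{\mathrm{Sh}}(\alpha,\beta)=\mathrm{Sh}(\alpha,\beta[k])$, $k$ is the largest letter of $\alpha$ ($0$ if $\alpha$ is empty), and $\beta[k]$ is $\beta$ with $k$ added to each letter. *)

theory Defs
  imports Complex_Main "HOL-Library.Multiset" "HOL-Library.Poly_Mapping"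
    "HOL-Algebra.QuotRing" "HOL-Algebra.Module"
begin

section \<open>Words and shuffles\<close>

definition words :: "nat list set" where
  "words = {\<alpha>. \<forall>a\<in>set \<alpha>. 0 < a}"

text \<open>The letter \<open>a\<^sub>i\<close> among the distinct letters \<open>a\<^sub>1 < \<dots> < a\<^sub>k\<close> has exactly
  \<open>i\<close> letters that are at most \<open>a\<^sub>i\<close>.\<close>

definition pack :: "nat list \<Rightarrow> nat list" where
  "pack \<alpha> = map (\<lambda>a. card {b \<in> set \<alpha>. b \<le> a}) \<alpha>"

definition packed_words :: "nat list set" where
  "packed_words = {\<alpha> \<in> words. pack \<alpha> = \<alpha>}"

definition disjoint_words :: "nat list \<Rightarrow> nat list \<Rightarrow> bool" where
  "disjoint_words \<alpha> \<beta> \<longleftrightarrow> set \<alpha> \<inter> set \<beta> = {}"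

text \<open>Unlike the library's \<^const>\<open>shuffles\<close>, which is a set, this counts interleavings with
  multiplicity.\<close>

fun Sh :: "'a list \<Rightarrow> 'a list \<Rightarrow> 'a list multiset" where
  "Sh [] ys = {#ys#}"
| "Sh xs [] = {#xs#}"
| "Sh (x # xs) (y # ys) =
     image_mset ((#) x) (Sh xs (y # ys)) + image_mset ((#) y) (Sh (x # xs) ys)"

lemma set_mset_Sh: "set_mset (Sh xs ys) = shuffles xs ys"
  by (induction xs ys rule: Sh.induct) (auto simp: shuffles.simps)

lemma size_Sh: "size (Sh xs ys) = (length xs + length ys) choose length xs"
  by (induction xs ys rule: Sh.induct) (simp_all add: add.commute)

definition shift_word :: "nat list \<Rightarrow> nat \<Rightarrow> nat list" where
  "shift_word \<beta> k = map (\<lambda>b. b + k) \<beta>"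

definition shifted_Sh :: "nat list \<Rightarrow> nat list \<Rightarrow> nat list multiset" where
  "shifted_Sh \<alpha> \<beta> = Sh \<alpha> (shift_word \<beta> (Max (insert 0 (set \<alpha>))))"

text \<open>A statistic is a function on \<^const>\<open>words\<close>; its values on lists containing \<open>0\<close> are
  never used.\<close>

definition shuffle_compatible_on_words :: "(nat list \<Rightarrow> 's) \<Rightarrow> bool" where
  "shuffle_compatible_on_words st \<longleftrightarrow>
     (\<forall>\<alpha>\<in>words. \<forall>\<beta>\<in>words. \<forall>\<alpha>'\<in>words. \<forall>\<beta>'\<in>words.
        disjoint_words \<alpha> \<beta> \<and> disjoint_words \<alpha>' \<beta>' \<and>
        length \<alpha> = length \<alpha>' \<and> length \<beta> = length \<beta>' \<and> st \<alpha> = st \<alpha>' \<and> st \<beta> = st \<beta>' \<longrightarrow>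
        image_mset st (Sh \<alpha> \<beta>) = image_mset st (Sh \<alpha>' \<beta>')) \<and>
     (\<forall>\<alpha>\<in>words. \<forall>\<beta>\<in>words. pack \<alpha> = pack \<beta> \<longrightarrow> st \<alpha> = st \<beta>)"


section \<open>Algebras over the rationals\<close>

definition rat_ring :: "rat ring" where
  "rat_ring = \<lparr>carrier = UNIV, mult = (*), one = 1, zero = 0, add = (+)\<rparr>"

text \<open>The library locale \<^locale>\<open>algebra\<close> assumes commutativity, which fails here.\<close>

locale rat_algebra = ring A + module rat_ring A for A (structure) +
  assumes smult_mult_left:
      "\<lbrakk>x \<in> carrier A; y \<in> carrier A\<rbrakk> \<Longrightarrow> (c \<odot> x) \<otimes> y = c \<odot> (x \<otimes> y)"
    and smult_mult_right:
      "\<lbrakk>x \<in> carrier A; y \<in> carrier A\<rbrakk> \<Longrightarrow> x \<otimes> (c \<odot> y) = c \<odot> (x \<otimes> y)"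

definition rat_algebra_isomorphic ::
  "(rat, 'a, 'm) module_scheme \<Rightarrow> (rat, 'b, 'n) module_scheme \<Rightarrow> bool" where
  "rat_algebra_isomorphic A B \<longleftrightarrow> rat_algebra A \<and> rat_algebra B \<and>
     (\<exists>\<phi> \<in> ring_iso A B. \<forall>c. \<forall>x \<in> carrier A. \<phi> (c \<odot>\<^bsub>A\<^esub> x) = c \<odot>\<^bsub>B\<^esub> \<phi> x)"

text \<open>The ring \<open>A Quot I\<close> with the induced scalar multiplication \<open>c (I + x) = I + c x\<close>.
  A two-sided ideal \<open>I\<close> of the ring \<open>A\<close> is automatically closed under scalars because
  \<open>A\<close> is unital.\<close>

definition quotient_algebra ::
  "(rat, 'a, 'm) module_scheme \<Rightarrow> 'a set \<Rightarrow> (rat, 'a set) module" where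
  "quotient_algebra A I =
     \<lparr>carrier = carrier (A Quot I), mult = mult (A Quot I), one = one (A Quot I),
      zero = zero (A Quot I), add = add (A Quot I),
      smult = (\<lambda>c X. \<Union>x\<in>X. I +>\<^bsub>A\<^esub> (c \<odot>\<^bsub>A\<^esub> x))\<rparr>"

text \<open>The algebra with basis \<open>B\<close>, unit the basis element \<open>e\<close>, and product the bilinear
  extension of \<open>b b' = \<Sum>\<gamma>\<in>P b b'. \<gamma>\<close> on basis elements, where \<open>P b b'\<close> is a multiset of
  basis elements.\<close>

definition basis_algebra ::
  "'b set \<Rightarrow> 'b \<Rightarrow> ('b \<Rightarrow> 'b \<Rightarrow> 'b multiset) \<Rightarrow> (rat, 'b \<Rightarrow>\<^sub>0 rat) module" where
  "basis_algebra B e P =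
     \<lparr>carrier = {f. Poly_Mapping.keys f \<subseteq> B},
      mult = (\<lambda>f g. \<Sum>a\<in>Poly_Mapping.keys f. \<Sum>b\<in>Poly_Mapping.keys g. \<Sum>\<gamma>\<in>#P a b.
        Poly_Mapping.single \<gamma> (Poly_Mapping.lookup f a * Poly_Mapping.lookup g b)),
      one = Poly_Mapping.single e 1,
      zero = 0,
      add = (+),
      smult = (\<lambda>c f. Poly_Mapping.map ((*) c) f)\<rparr>"


section \<open>The two algebras\<close>

text \<open>The dual of \<open>WQSym\<close>; the packed word \<open>\<alpha>\<close> stands for the basis element
  \<open>M\<^sup>*\<^sub>\<alpha>\<close>.\<close>

definition WQSym_dual :: "(rat, nat list \<Rightarrow>\<^sub>0 rat) module" where
  "WQSym_dual = basis_algebra packed_words [] shifted_Sh"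

definition st_class :: "(nat list \<Rightarrow> 's) \<Rightarrow> nat list \<Rightarrow> nat list set" where
  "st_class st \<alpha> = {\<beta> \<in> words. st \<beta> = st \<alpha> \<and> length \<beta> = length \<alpha>}"

text \<open>The multiset of classes \<open>[\<gamma>]\<close>, \<open>\<gamma> \<in> Sh(\<alpha>, \<beta>)\<close>, that arises from disjoint
  representatives \<open>\<alpha> \<in> C\<close> and \<open>\<beta> \<in> D\<close>. It does not depend on the representatives if
  \<open>st\<close> is shuffle-compatible; see \<open>class_product_eq\<close> and \<open>ex_disjoint_representatives\<close> below.\<close>

definition class_product ::
  "(nat list \<Rightarrow> 's) \<Rightarrow> nat list set \<Rightarrow> nat list set \<Rightarrow> nat list set multiset" where
  "class_product st C D =
     (THE M. \<exists>\<alpha>\<in>C. \<exists>\<beta>\<in>D. disjoint_words \<alpha> \<beta> \<and> M = image_mset (st_class st) (Sh \<alpha> \<beta>))"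

definition shuffle_algebra :: "(nat list \<Rightarrow> 's) \<Rightarrow> (rat, nat list set \<Rightarrow>\<^sub>0 rat) module" where
  "shuffle_algebra st = basis_algebra (st_class st ` words) (st_class st []) (class_product st)"

lemma image_st_class_Sh:
  "image_mset (st_class st) (Sh \<alpha> \<beta>) =
   image_mset (\<lambda>s. {\<delta>\<in>words. st \<delta> = s \<and> length \<delta> = length \<alpha> + length \<beta>})
     (image_mset st (Sh \<alpha> \<beta>))"
  unfolding multiset.map_comp
  by (rule image_mset_cong) (auto simp: st_class_def set_mset_Sh length_shuffles)

lemma class_product_eq:
  assumes "shuffle_compatible_on_words st" "\<alpha> \<in> words" "\<beta> \<in> words" "disjoint_words \<alpha> \<beta>"
  shows "class_product st (st_class st \<alpha>) (st_class st \<beta>) = image_mset (st_class st) (Sh \<alpha> \<beta>)"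
  unfolding class_product_def
proof (rule the_equality)
  show "\<exists>\<alpha>'\<in>st_class st \<alpha>. \<exists>\<beta>'\<in>st_class st \<beta>. disjoint_words \<alpha>' \<beta>' \<and>
      image_mset (st_class st) (Sh \<alpha> \<beta>) = image_mset (st_class st) (Sh \<alpha>' \<beta>')"
    using assms by (intro bexI[of _ \<alpha>] bexI[of _ \<beta>]) (auto simp: st_class_def)
next
  fix M
  assume "\<exists>\<alpha>'\<in>st_class st \<alpha>. \<exists>\<beta>'\<in>st_class st \<beta>. disjoint_words \<alpha>' \<beta>' \<and>
      M = image_mset (st_class st) (Sh \<alpha>' \<beta>')"
  then obtain \<alpha>' \<beta>' where *: "\<alpha>' \<in> words" "\<beta>' \<in> words" "disjoint_words \<alpha>' \<beta>'"
      "st \<alpha>' = st \<alpha>" "st \<beta>' = st \<beta>" "length \<alpha>' = length \<alpha>" "length \<beta>' = length \<beta>"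
      "M = image_mset (st_class st) (Sh \<alpha>' \<beta>')"
    by (auto simp: st_class_def)
  have "image_mset st (Sh \<alpha>' \<beta>') = image_mset st (Sh \<alpha> \<beta>)"
    using assms * unfolding shuffle_compatible_on_words_def by blast
  with * show "M = image_mset (st_class st) (Sh \<alpha> \<beta>)"
    by (simp only: image_st_class_Sh)
qed

lemma pack_shift_word: "pack (shift_word \<beta> k) = pack \<beta>"
proof -
  have "{b \<in> (\<lambda>b. b + k) ` set \<beta>. b \<le> a + k} = (\<lambda>b. b + k) ` {b \<in> set \<beta>. b \<le> a}" for a
    by auto
  then have "card {b \<in> (\<lambda>b. b + k) ` set \<beta>. b \<le> a + k} = card {b \<in> set \<beta>. b \<le> a}" for a
    by (simp add: card_image inj_on_def)
  then show ?thesis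
    by (simp add: pack_def shift_word_def)
qed

lemma ex_disjoint_representatives:
  assumes "shuffle_compatible_on_words st" "\<alpha> \<in> words" "\<beta> \<in> words"
  shows "\<exists>\<beta>'\<in>words. disjoint_words \<alpha> \<beta>' \<and> st_class st \<beta>' = st_class st \<beta>"
proof (intro bexI conjI)
  let ?k = "Max (insert 0 (set \<alpha>))"
  let ?\<beta> = "shift_word \<beta> ?k"
  have pos: "\<forall>b\<in>set \<beta>. 0 < b"
    using assms(3) by (simp add: words_def)
  have le: "a \<le> ?k" if "a \<in> set \<alpha>" for a
    using that by (intro Max_ge) auto
  have gt: "?k < b" if "b \<in> set ?\<beta>" for b
  proof -
    from that obtain c where "c \<in> set \<beta>" "b = c + ?k"
      by (auto simp: shift_word_def)
    with pos show ?thesis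
      by (metis less_add_same_cancel2)
  qed
  show w: "?\<beta> \<in> words"
    unfolding words_def using gt by (blast intro: le_less_trans)
  show "disjoint_words \<alpha> ?\<beta>"
    unfolding disjoint_words_def using le gt by (meson disjoint_iff leD)
  have "st ?\<beta> = st \<beta>"
    using assms w pack_shift_word unfolding shuffle_compatible_on_words_def by blast
  then show "st_class st ?\<beta> = st_class st \<beta>"
    by (simp add: st_class_def shift_word_def)
qed

end

theory Submission
  imports Defs
begin

text \<open>Packing preserves the class of a word, so \<open>M\<^sup>*\<^sub>\<alpha> \<mapsto> [\<alpha>]\<close> maps the packed words onto all
  classes. The words \<open>\<alpha>\<close> and \<open>\<beta>[k]\<close> are disjoint representatives of \<open>[\<alpha>]\<close> and \<open>[\<beta>]\<close>, so this map is
  multiplicative, and its kernel is the desired ideal. Since it is surjective on bases, the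
  associativity and unit laws of the shuffle algebra are inherited from those of the dual of
  \<open>WQSym\<close>.\<close>

section \<open>Free vector spaces\<close>

text \<open>Passing the coefficient to \<open>h\<close> lets the target be any commutative monoid,
  so extensions can be nested into bilinear maps. Additivity of \<open>h a\<close> is a separate
  condition.\<close>

definition lin_ext :: "('a \<Rightarrow> rat \<Rightarrow> 'c) \<Rightarrow> ('a \<Rightarrow>\<^sub>0 rat) \<Rightarrow> 'c::comm_monoid_add" where
  "lin_ext h f = (\<Sum>a\<in>Poly_Mapping.keys f. h a (Poly_Mapping.lookup f a))"

definition scale :: "rat \<Rightarrow> ('a \<Rightarrow>\<^sub>0 rat) \<Rightarrow> 'a \<Rightarrow>\<^sub>0 rat" where
  "scale c f = Poly_Mapping.map ((*) c) f"

definition sum_basis :: "'a multiset \<Rightarrow> rat \<Rightarrow> 'a \<Rightarrow>\<^sub>0 rat" where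
  "sum_basis M c = (\<Sum>\<gamma>\<in>#M. Poly_Mapping.single \<gamma> c)"

definition basis_mult ::
  "('a \<Rightarrow> 'a \<Rightarrow> 'a multiset) \<Rightarrow> ('a \<Rightarrow>\<^sub>0 rat) \<Rightarrow> ('a \<Rightarrow>\<^sub>0 rat) \<Rightarrow> 'a \<Rightarrow>\<^sub>0 rat" where
  "basis_mult P f g = lin_ext (\<lambda>a c. lin_ext (\<lambda>b d. sum_basis (P a b) (c * d)) g) f"

text \<open>Coefficients of basis elements with the same image under \<open>q\<close> add up. For
  \<open>q = st_class st\<close> this becomes the projection onto the shuffle algebra.\<close>

definition map_basis :: "('a \<Rightarrow> 'b) \<Rightarrow> ('a \<Rightarrow>\<^sub>0 rat) \<Rightarrow> 'b \<Rightarrow>\<^sub>0 rat" where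
  "map_basis q = lin_ext (\<lambda>a. Poly_Mapping.single (q a))"

lemma basis_algebra_simps [simp]:
  "carrier (basis_algebra B e P) = {f. Poly_Mapping.keys f \<subseteq> B}"
  "mult (basis_algebra B e P) = basis_mult P"
  "one (basis_algebra B e P) = Poly_Mapping.single e 1"
  "zero (basis_algebra B e P) = 0"
  "add (basis_algebra B e P) = (+)"
  "smult (basis_algebra B e P) = scale"
  by (simp_all add: basis_algebra_def basis_mult_def lin_ext_def sum_basis_def scale_def fun_eq_iff)

lemma lin_ext_0 [simp]: "lin_ext h 0 = 0"
  by (simp add: lin_ext_def)

text \<open>\<open>Poly_Mapping.single a 0\<close> has no keys, so for \<open>c = 0\<close> the left
  side is an empty sum; the premise covers this case.\<close>

lemma lin_ext_single [simp]: "h a 0 = 0 \<Longrightarrow> lin_ext h (Poly_Mapping.single a c) = h a c"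
  by (simp add: lin_ext_def)

text \<open>Cancellation may remove keys from \<open>f + g\<close>; as \<open>h a 0 = 0\<close>, the
  lost terms contribute nothing.\<close>

lemma lin_ext_add:
  assumes "\<And>a. h a 0 = 0" "\<And>a c d. h a (c + d) = h a c + h a d"
  shows "lin_ext h (f + g) = lin_ext h f + lin_ext h g"
  unfolding lin_ext_def by (rule setsum_keys_plus_distrib) (simp_all add: assms)

lemma lin_ext_zero_fun [simp]: "lin_ext (\<lambda>a c. 0) f = 0"
  by (simp add: lin_ext_def)

lemma lin_ext_add_fun: "lin_ext (\<lambda>a c. h a c + h' a c) f = lin_ext h f + lin_ext h' f"
  by (simp add: lin_ext_def sum.distrib)

lemma lookup_scale [simp]: "Poly_Mapping.lookup (scale c f) a = c * Poly_Mapping.lookup f a"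
  by (simp add: scale_def Poly_Mapping.map.rep_eq when_def)

lemma keys_scale: "Poly_Mapping.keys (scale c f) \<subseteq> Poly_Mapping.keys f"
  by (auto simp: in_keys_iff)

lemma scale_0_right [simp]: "scale c 0 = 0"
  by (rule poly_mapping_eqI) simp

lemma scale_add: "scale c (f + g) = scale c f + scale c g"
  by (rule poly_mapping_eqI) (simp add: lookup_add algebra_simps)

lemma scale_single [simp]: "scale c (Poly_Mapping.single a d) = Poly_Mapping.single a (c * d)"
  by (rule poly_mapping_eqI) (simp add: lookup_single when_def)

lemma sum_basis_empty [simp]: "sum_basis {#} c = 0"
  by (simp add: sum_basis_def)

lemma sum_basis_add_mset [simp]:
  "sum_basis (add_mset a M) c = Poly_Mapping.single a c + sum_basis M c"
  by (simp add: sum_basis_def)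

lemma sum_basis_union [simp]: "sum_basis (M + N) c = sum_basis M c + sum_basis N c"
  by (simp add: sum_basis_def)

lemma sum_basis_0 [simp]: "sum_basis M 0 = 0"
  by (simp add: sum_basis_def)

lemma sum_basis_add: "sum_basis M (c + d) = sum_basis M c + sum_basis M d"
  by (simp add: sum_basis_def single_add sum_mset.distrib)

lemma scale_sum_basis [simp]: "scale c (sum_basis M d) = sum_basis M (c * d)"
  by (induction M) (simp_all add: scale_add)

lemma keys_add_subset:
  "\<lbrakk>Poly_Mapping.keys f \<subseteq> B; Poly_Mapping.keys g \<subseteq> B\<rbrakk> \<Longrightarrow> Poly_Mapping.keys (f + g) \<subseteq> B"
  using keys_add[of f g] by blast

lemma keys_sum_basis: "Poly_Mapping.keys (sum_basis M c) \<subseteq> set_mset M"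
proof (induction M)
  case (add a M)
  then show ?case
    by (simp only: sum_basis_add_mset) (rule keys_add_subset, auto)
qed simp

lemma image_mset_sum_mset:
  "image_mset q (\<Sum>x\<in>#M. N x) = (\<Sum>x\<in>#M. image_mset q (N x))"
  by (induction M) simp_all

lemma basis_mult_0_left [simp]: "basis_mult P 0 g = 0"
  by (simp add: basis_mult_def)

lemma basis_mult_0_right [simp]: "basis_mult P f 0 = 0"
  by (simp add: basis_mult_def)

lemma basis_mult_single [simp]:
  "basis_mult P (Poly_Mapping.single a c) (Poly_Mapping.single b d) = sum_basis (P a b) (c * d)"
  by (simp add: basis_mult_def)

lemma basis_mult_add_left: "basis_mult P (f + f') g = basis_mult P f g + basis_mult P f' g"
  unfolding basis_mult_def
  by (rule lin_ext_add) (simp_all add: distrib_right sum_basis_add lin_ext_add_fun)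

text \<open>The inner extension over \<open>g\<close> is split first; the sum then passes through
  the outer one by \<open>lin_ext_add_fun\<close>.\<close>

lemma basis_mult_add_right: "basis_mult P f (g + g') = basis_mult P f g + basis_mult P f g'"
  unfolding basis_mult_def
  by (subst lin_ext_add) (simp_all add: distrib_left sum_basis_add lin_ext_add_fun)

lemma map_basis_0 [simp]: "map_basis q 0 = 0"
  by (simp add: map_basis_def)

lemma map_basis_single [simp]:
  "map_basis q (Poly_Mapping.single a c) = Poly_Mapping.single (q a) c"
  by (simp add: map_basis_def)

lemma map_basis_add: "map_basis q (f + g) = map_basis q f + map_basis q g"
  unfolding map_basis_def by (rule lin_ext_add) (simp_all add: single_add)

lemma map_basis_sum_basis [simp]: "map_basis q (sum_basis M c) = sum_basis (image_mset q M) c"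
  by (induction M) (simp_all add: map_basis_add)

text \<open>Each \<open>f\<close> is a finite sum of monomials with keys in \<open>B\<close>. This
  reduces the linear, bilinear and trilinear identities below to basis elements.\<close>

lemma keys_subset_induct [consumes 1, case_names zero single add]:
  fixes f :: "'a \<Rightarrow>\<^sub>0 rat"
  assumes "Poly_Mapping.keys f \<subseteq> B"
    and zero: "Q 0"
    and single: "\<And>a c. a \<in> B \<Longrightarrow> Q (Poly_Mapping.single a c)"
    and add: "\<And>f g. \<lbrakk>Poly_Mapping.keys f \<subseteq> B; Poly_Mapping.keys g \<subseteq> B; Q f; Q g\<rbrakk> \<Longrightarrow> Q (f + g)"
  shows "Q f"
proof -
  \<comment> \<open>The support bound belongs to the induction claim because \<open>add\<close> asks
    for it on both summands.\<close>
  have part: "Poly_Mapping.keys (\<Sum>a\<in>A. Poly_Mapping.single a (Poly_Mapping.lookup f a)) \<subseteq> B \<and>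
      Q (\<Sum>a\<in>A. Poly_Mapping.single a (Poly_Mapping.lookup f a))" if "finite A" "A \<subseteq> B" for A
    using that
  proof (induction A rule: finite_induct)
    case empty
    show ?case by (simp add: zero)
  next
    case (insert a A)
    let ?s = "Poly_Mapping.single a (Poly_Mapping.lookup f a)"
    let ?r = "\<Sum>a\<in>A. Poly_Mapping.single a (Poly_Mapping.lookup f a)"
    have s: "Poly_Mapping.keys ?s \<subseteq> B" "Q ?s"
      using insert.prems single by auto
    have r: "Poly_Mapping.keys ?r \<subseteq> B" "Q ?r"
      using insert by auto
    have "Poly_Mapping.keys (?s + ?r) \<subseteq> B"
      using keys_add[of ?s ?r] s(1) r(1) by blast
    moreover have "Q (?s + ?r)"
      by (rule add) (fact s r)+
    ultimately show ?case
      using insert.hyps by simp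
  qed
  have "f = (\<Sum>a\<in>Poly_Mapping.keys f. Poly_Mapping.single a (Poly_Mapping.lookup f a))"
    by (rule poly_mapping_eqI) (simp add: lookup_sum lookup_single when_def in_keys_iff)
  with part[OF finite_keys assms(1)] show ?thesis
    by simp
qed

lemmas free_induct [case_names zero single add] =
  keys_subset_induct[where B = UNIV, OF subset_UNIV, consumes 0]

text \<open>By bilinearity two basis elements suffice, and their product is supported on
  \<open>P a b\<close>.\<close>

lemma keys_basis_mult:
  assumes "Poly_Mapping.keys f \<subseteq> B" "Poly_Mapping.keys g \<subseteq> B"
    and "\<And>a b. \<lbrakk>a \<in> B; b \<in> B\<rbrakk> \<Longrightarrow> set_mset (P a b) \<subseteq> B"
  shows "Poly_Mapping.keys (basis_mult P f g) \<subseteq> B"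
  using assms(1)
proof (induction f rule: keys_subset_induct)
  case (single a c)
  show ?case using assms(2)
  proof (induction g rule: keys_subset_induct)
    case (single b d)
    with \<open>a \<in> B\<close> assms(3) keys_sum_basis show ?case
      by (metis basis_mult_single subset_trans)
  qed (simp_all add: basis_mult_add_right keys_add_subset)
qed (simp_all add: basis_mult_add_left keys_add_subset)

lemma basis_mult_scale_left: "basis_mult P (scale c f) g = scale c (basis_mult P f g)"
proof (induction f rule: free_induct)
  case (single a d)
  show ?case
    by (induction g rule: free_induct)
      (simp_all add: basis_mult_add_right scale_add mult_ac)
qed (simp_all add: basis_mult_add_left scale_add)

lemma basis_mult_scale_right: "basis_mult P f (scale c g) = scale c (basis_mult P f g)"
proof (induction f rule: free_induct)
  case (single a d)
  show ?case
    by (induction g rule: free_induct)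
      (simp_all add: basis_mult_add_right scale_add mult_ac)
qed (simp_all add: basis_mult_add_left scale_add)

section \<open>Linear maps induced by maps of bases\<close>

lemma map_basis_scale: "map_basis q (scale c f) = scale c (map_basis q f)"
  by (induction f rule: free_induct)
    (simp_all add: map_basis_add scale_add)

lemma keys_map_basis:
  assumes "Poly_Mapping.keys f \<subseteq> B"
  shows "Poly_Mapping.keys (map_basis q f) \<subseteq> q ` B"
  using assms by (induction f rule: keys_subset_induct) (simp_all add: map_basis_add keys_add_subset)

lemma map_basis_surj:
  assumes "Poly_Mapping.keys g \<subseteq> q ` B"
  shows "\<exists>f. Poly_Mapping.keys f \<subseteq> B \<and> map_basis q f = g"
  using assms
proof (induction g rule: keys_subset_induct)
  case zero
  show ?case by (intro exI[of _ 0]) simp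
next
  case (single b c)
  then obtain a where "a \<in> B" "b = q a" by blast
  then show ?case by (intro exI[of _ "Poly_Mapping.single a c"]) simp
next
  case (add g g')
  then obtain f f' where "Poly_Mapping.keys f \<subseteq> B" "map_basis q f = g"
    "Poly_Mapping.keys f' \<subseteq> B" "map_basis q f' = g'" by blast
  then show ?case by (intro exI[of _ "f + f'"]) (simp add: map_basis_add keys_add_subset)
qed

lemma map_basis_image:
  "map_basis q ` {f. Poly_Mapping.keys f \<subseteq> B} = {g. Poly_Mapping.keys g \<subseteq> q ` B}"
proof
  show "{g. Poly_Mapping.keys g \<subseteq> q ` B} \<subseteq> map_basis q ` {f. Poly_Mapping.keys f \<subseteq> B}"
    using map_basis_surj[of _ q B] by blast
qed (use keys_map_basis[of _ B q] in blast)

text \<open>Both sides are bilinear in \<open>f\<close> and \<open>g\<close>, so it suffices that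
  \<open>q\<close> carries the structure constants \<open>P\<close> on \<open>B\<close> to
  \<open>P'\<close>.\<close>

lemma map_basis_mult:
  assumes "Poly_Mapping.keys f \<subseteq> B" "Poly_Mapping.keys g \<subseteq> B"
    and "\<And>a b. \<lbrakk>a \<in> B; b \<in> B\<rbrakk> \<Longrightarrow> P' (q a) (q b) = image_mset q (P a b)"
  shows "map_basis q (basis_mult P f g) = basis_mult P' (map_basis q f) (map_basis q g)"
  using assms(1)
proof (induction f rule: keys_subset_induct)
  case (single a c)
  show ?case using assms(2)
    by (induction g rule: keys_subset_induct)
      (simp_all add: single assms(3) basis_mult_add_right map_basis_add)
qed (simp_all add: basis_mult_add_left map_basis_add)


section \<open>Algebras with a basis\<close>

text \<open>The unital associative algebra axioms on the level of structure constants. The sums in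
  \<open>assoc\<close> are multiset unions, so both sides list the basis elements of a triple
  product with multiplicity.\<close>

locale monoid_basis =
  fixes B :: "'b set" and e :: 'b and P :: "'b \<Rightarrow> 'b \<Rightarrow> 'b multiset"
  assumes unit_in: "e \<in> B"
    and closed: "\<And>a b. \<lbrakk>a \<in> B; b \<in> B\<rbrakk> \<Longrightarrow> set_mset (P a b) \<subseteq> B"
    and unit_left: "\<And>a. a \<in> B \<Longrightarrow> P e a = {#a#}"
    and unit_right: "\<And>a. a \<in> B \<Longrightarrow> P a e = {#a#}"
    and assoc: "\<And>a b c. \<lbrakk>a \<in> B; b \<in> B; c \<in> B\<rbrakk> \<Longrightarrow>
      (\<Sum>x\<in>#P a b. P x c) = (\<Sum>x\<in>#P b c. P a x)"

text \<open>Brings an iterated product of basis elements into the form in which \<open>assoc\<close>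
  is stated.\<close>

lemma sum_basis_mult_single:
  "basis_mult P (sum_basis M c) (Poly_Mapping.single b d) = sum_basis (\<Sum>x\<in>#M. P x b) (c * d)"
  by (induction M) (simp_all add: basis_mult_add_left)

lemma single_mult_sum_basis:
  "basis_mult P (Poly_Mapping.single a c) (sum_basis M d) = sum_basis (\<Sum>x\<in>#M. P a x) (c * d)"
  by (induction M) (simp_all add: basis_mult_add_right)

lemma (in monoid_basis) basis_mult_assoc:
  assumes "Poly_Mapping.keys f \<subseteq> B" "Poly_Mapping.keys g \<subseteq> B" "Poly_Mapping.keys h \<subseteq> B"
  shows "basis_mult P (basis_mult P f g) h = basis_mult P f (basis_mult P g h)"
  using assms(1)
proof (induction f rule: keys_subset_induct)
  case (single a c)
  show ?case using assms(2)
  proof (induction g rule: keys_subset_induct)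
    case (single b d)
    show ?case using assms(3)
      by (induction h rule: keys_subset_induct)
        (simp_all add: sum_basis_mult_single single_mult_sum_basis assoc \<open>a \<in> B\<close> \<open>b \<in> B\<close>
          basis_mult_add_right mult.assoc)
  qed (simp_all add: basis_mult_add_left basis_mult_add_right)
qed (simp_all add: basis_mult_add_left)

lemma (in monoid_basis) basis_mult_unit_left:
  "Poly_Mapping.keys f \<subseteq> B \<Longrightarrow> basis_mult P (Poly_Mapping.single e 1) f = f"
  by (induction f rule: keys_subset_induct) (simp_all add: unit_left basis_mult_add_right)

lemma (in monoid_basis) basis_mult_unit_right:
  "Poly_Mapping.keys f \<subseteq> B \<Longrightarrow> basis_mult P f (Poly_Mapping.single e 1) = f"
  by (induction f rule: keys_subset_induct) (simp_all add: unit_right basis_mult_add_left)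

section \<open>Rational scalars and the algebra axioms\<close>

lemma rat_ring_simps [simp]:
  "carrier rat_ring = UNIV" "mult rat_ring = (*)" "one rat_ring = 1" "zero rat_ring = 0"
  "add rat_ring = (+)"
  by (simp_all add: rat_ring_def)

lemma cring_rat_ring: "cring rat_ring"
proof (intro cringI abelian_groupI comm_monoidI)
  fix x assume "x \<in> carrier rat_ring"
  show "\<exists>y\<in>carrier rat_ring. y \<oplus>\<^bsub>rat_ring\<^esub> x = \<zero>\<^bsub>rat_ring\<^esub>"
    by (rule bexI[of _ "- x"]) simp_all
qed (simp_all add: algebra_simps)

lemma (in monoid_basis) rat_algebra: "rat_algebra (basis_algebra B e P)"
proof -
  let ?A = "basis_algebra B e P"
  have group: "abelian_group ?A"
  proof (rule abelian_groupI)
    fix x assume "x \<in> carrier ?A"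
    then show "\<exists>y\<in>carrier ?A. y \<oplus>\<^bsub>?A\<^esub> x = \<zero>\<^bsub>?A\<^esub>"
      by (intro bexI[of _ "- x"]) simp_all
  qed (simp_all add: keys_add_subset add_ac)
  have "monoid ?A"
    by (rule monoidI)
      (simp_all add: unit_in keys_basis_mult closed basis_mult_assoc basis_mult_unit_left
        basis_mult_unit_right)
  with group have "ring ?A"
    by (intro ringI) (simp_all add: abelian_group_def monoid_def basis_mult_add_left
        basis_mult_add_right)
  moreover have "module rat_ring ?A"
  proof (rule moduleI[OF cring_rat_ring group])
    show "(a \<oplus>\<^bsub>rat_ring\<^esub> b) \<odot>\<^bsub>?A\<^esub> x = a \<odot>\<^bsub>?A\<^esub> x \<oplus>\<^bsub>?A\<^esub> b \<odot>\<^bsub>?A\<^esub> x" for a b x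
      by (simp, rule poly_mapping_eqI) (simp add: lookup_add algebra_simps)
    show "(a \<otimes>\<^bsub>rat_ring\<^esub> b) \<odot>\<^bsub>?A\<^esub> x = a \<odot>\<^bsub>?A\<^esub> (b \<odot>\<^bsub>?A\<^esub> x)" for a b x
      by (simp, rule poly_mapping_eqI) simp
    show "\<one>\<^bsub>rat_ring\<^esub> \<odot>\<^bsub>?A\<^esub> x = x" for x
      by (simp, rule poly_mapping_eqI) simp
    show "a \<odot>\<^bsub>?A\<^esub> x \<in> carrier ?A" if "x \<in> carrier ?A" for a x
      using that keys_scale[of a x] by auto
  qed (simp_all add: scale_add)
  ultimately show ?thesis
    by (simp add: rat_algebra_def rat_algebra_axioms_def basis_mult_scale_left
        basis_mult_scale_right)
qed

lemma (in monoid_basis) monoid_basis_image: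
  assumes "\<And>a b. \<lbrakk>a \<in> B; b \<in> B\<rbrakk> \<Longrightarrow> P' (q a) (q b) = image_mset q (P a b)"
  shows "monoid_basis (q ` B) (q e) P'"
proof
  fix x y z assume "x \<in> q ` B" "y \<in> q ` B" "z \<in> q ` B"
  then obtain a b c where abc: "a \<in> B" "b \<in> B" "c \<in> B" "x = q a" "y = q b" "z = q c"
    by blast
  have "(\<Sum>x\<in>#P' (q a) (q b). P' x (q c)) = (\<Sum>x\<in>#P a b. image_mset q (P x c))"
    \<comment> \<open>Closure puts the elements of \<open>P a b\<close> in \<open>B\<close>, so the
      hypothesis applies to the second product as well.\<close>
    using abc closed[of a b]
    by (auto simp: assms multiset.map_comp intro!: arg_cong[of _ _ sum_mset] image_mset_cong)
  also have "\<dots> = image_mset q (\<Sum>x\<in>#P a b. P x c)"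
    by (simp add: image_mset_sum_mset)
  also have "\<dots> = image_mset q (\<Sum>x\<in>#P b c. P a x)"
    using abc by (simp add: assoc)
  also have "\<dots> = (\<Sum>x\<in>#P b c. image_mset q (P a x))"
    by (simp add: image_mset_sum_mset)
  also have "\<dots> = (\<Sum>x\<in>#P' (q b) (q c). P' (q a) x)"
    using abc closed[of b c]
    by (auto simp: assms multiset.map_comp intro!: arg_cong[of _ _ sum_mset] image_mset_cong)
  finally show "(\<Sum>u\<in>#P' x y. P' u z) = (\<Sum>u\<in>#P' y z. P' x u)"
    using abc by simp
next
  fix x y assume "x \<in> q ` B" "y \<in> q ` B"
  then obtain a b where "a \<in> B" "b \<in> B" "x = q a" "y = q b"
    by blast
  then show "set_mset (P' x y) \<subseteq> q ` B"
    using closed[of a b] by (auto simp: assms)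
qed (auto simp: assms unit_in unit_left unit_right)


section \<open>Quotients of rational algebras\<close>

lemma quotient_algebra_simps [simp]:
  "carrier (quotient_algebra A I) = carrier (A Quot I)"
  "mult (quotient_algebra A I) = mult (A Quot I)"
  "one (quotient_algebra A I) = one (A Quot I)"
  "zero (quotient_algebra A I) = zero (A Quot I)"
  "add (quotient_algebra A I) = add (A Quot I)"
  by (simp_all add: quotient_algebra_def)

text \<open>The records \<open>A Quot I\<close> and \<open>quotient_algebra A I\<close> have
  different types but the same ring operations, so the axioms are transferred one at a time.\<close>

lemma ring_quotient_algebra:
  assumes "ideal I A"
  shows "ring (quotient_algebra A I)"
proof -
  interpret Q: ring "A Quot I" using assms by (rule ideal.quotient_is_ring)
  let ?Q = "quotient_algebra A I"
  have group: "abelian_group ?Q"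
  proof (rule abelian_groupI)
    fix X assume "X \<in> carrier ?Q"
    then show "\<exists>Y\<in>carrier ?Q. Y \<oplus>\<^bsub>?Q\<^esub> X = \<zero>\<^bsub>?Q\<^esub>"
      using Q.l_neg by (intro bexI[of _ "\<ominus>\<^bsub>A Quot I\<^esub> X"]) simp_all
  qed (simp_all add: Q.a_ac)
  moreover have "Group.monoid ?Q"
    by (rule monoidI) (simp_all add: Q.m_assoc)
  ultimately show "ring ?Q"
    by (intro ringI) (simp_all add: Q.l_distr Q.r_distr)
qed

context rat_algebra
begin

lemma smult_ideal:
  assumes "ideal I A" "x \<in> I"
  shows "c \<odot> x \<in> I"
proof -
  interpret ideal I A by fact
  have x: "x \<in> carrier A" using assms(2) by (rule a_Hcarr)
  \<comment> \<open>Scaling by \<open>c\<close> is multiplication by the ring element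
    \<open>c \<odot> \<one>\<close>, which the ideal absorbs.\<close>
  have "(c \<odot> \<one>) \<otimes> x \<in> I"
    using assms(2) by (intro I_l_closed) simp_all
  then show ?thesis
    using x by (simp add: smult_mult_left)
qed

text \<open>Representatives of one coset differ by an element of \<open>I\<close>, and so do their
  multiples by \<open>c\<close>; hence all members of the union defining the scalar action
  coincide.\<close>

lemma smult_quotient:
  assumes "ideal I A" "x \<in> carrier A"
  shows "c \<odot>\<^bsub>quotient_algebra A I\<^esub> (I +> x) = I +> (c \<odot> x)"
proof -
  interpret ideal I A by fact
  have "I +> (c \<odot> y) = I +> (c \<odot> x)" if "y \<in> I +> x" for y
  proof -
    from that obtain i where i: "i \<in> I" "y = i \<oplus> x"
      by (auto simp: a_r_coset_def r_coset_def)
    then have "c \<odot> y = c \<odot> i \<oplus> c \<odot> x"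
      using assms(2) a_Hcarr by (simp add: smult_r_distr)
    then have "c \<odot> y \<in> I +> (c \<odot> x)"
      using smult_ideal[OF assms(1) i(1)] by (auto simp: a_r_coset_def r_coset_def)
    then show ?thesis
      using assms(2) by (intro a_repr_independence'[symmetric]) simp_all
  qed
  \<comment> \<open>The index set must be nonempty for the union of equal cosets to be that
    coset.\<close>
  moreover have "x \<in> I +> x"
    using assms(2) by (rule a_rcos_self)
  ultimately have "(\<Union>y\<in>I +> x. I +> (c \<odot> y)) = I +> (c \<odot> x)"
    by (intro SUP_eq_const) blast+
  then show ?thesis
    by (simp only: quotient_algebra_def module.simps)
qed

text \<open>All operations are computed on representatives, where each law is a law of
  \<open>A\<close>.\<close>

lemma rat_algebra_quotient:
  assumes "ideal I A"
  shows "rat_algebra (quotient_algebra A I)"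
proof -
  interpret I: ideal I A by fact
  note ring_A = rat_algebra.axioms(1)[OF rat_algebra_axioms]
  have sum_closed: "x \<oplus> y \<in> carrier A" if "x \<in> carrier A" "y \<in> carrier A" for x y
    using ring_A that by (rule ring.ring_simprules)
  have prod_closed: "x \<otimes> y \<in> carrier A" if "x \<in> carrier A" "y \<in> carrier A" for x y
    using ring_A that by (rule ring.ring_simprules)
  let ?Q = "quotient_algebra A I"
  have ring: "ring ?Q"
    by (rule ring_quotient_algebra) fact
  then have group: "abelian_group ?Q"
    by (rule ring.is_abelian_group)
  have rep: "\<exists>x\<in>carrier A. X = I +> x" if "X \<in> carrier ?Q" for X
    using that by (auto simp: FactRing_def A_RCOSETS_def')
  have carr: "I +> x \<in> carrier ?Q" if "x \<in> carrier A" for x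
    using that by (auto simp: FactRing_def A_RCOSETS_def')
  have add: "(I +> x) \<oplus>\<^bsub>?Q\<^esub> (I +> y) = I +> (x \<oplus> y)" if "x \<in> carrier A" "y \<in> carrier A" for x y
    using that by (simp add: FactRing_def I.a_rcos_sum)
  have mult: "(I +> x) \<otimes>\<^bsub>?Q\<^esub> (I +> y) = I +> (x \<otimes> y)" if "x \<in> carrier A" "y \<in> carrier A" for x y
    using that by (simp add: FactRing_def I.rcoset_mult_add)
  note smult = smult_quotient[OF assms]
  have scalars: "c \<in> carrier rat_ring" for c by simp
  have "module rat_ring ?Q"
  proof (rule moduleI[OF cring_rat_ring group])
    fix a b X assume "X \<in> carrier ?Q"
    then obtain x where x: "x \<in> carrier A" "X = I +> x" using rep by blast
    show "a \<odot>\<^bsub>?Q\<^esub> X \<in> carrier ?Q"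
      unfolding x(2) smult[OF x(1)] using x(1) by (intro carr) simp
    show "(a \<oplus>\<^bsub>rat_ring\<^esub> b) \<odot>\<^bsub>?Q\<^esub> X = a \<odot>\<^bsub>?Q\<^esub> X \<oplus>\<^bsub>?Q\<^esub> b \<odot>\<^bsub>?Q\<^esub> X"
      unfolding x(2) smult[OF x(1)] using x(1) smult_l_distr[OF scalars scalars x(1), of a b]
      by (subst add) simp_all
    show "(a \<otimes>\<^bsub>rat_ring\<^esub> b) \<odot>\<^bsub>?Q\<^esub> X = a \<odot>\<^bsub>?Q\<^esub> (b \<odot>\<^bsub>?Q\<^esub> X)"
      unfolding x(2) smult[OF x(1)] using x(1) smult_assoc1[OF scalars scalars x(1), of a b]
      by (subst smult) simp_all
    show "\<one>\<^bsub>rat_ring\<^esub> \<odot>\<^bsub>?Q\<^esub> X = X"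
      unfolding x(2) smult[OF x(1)] using smult_one[OF x(1)] by simp
  next
    fix a X Y assume "X \<in> carrier ?Q" "Y \<in> carrier ?Q"
    then obtain x y where x: "x \<in> carrier A" "X = I +> x" "y \<in> carrier A" "Y = I +> y"
      using rep by metis
    then show "a \<odot>\<^bsub>?Q\<^esub> (X \<oplus>\<^bsub>?Q\<^esub> Y) = a \<odot>\<^bsub>?Q\<^esub> X \<oplus>\<^bsub>?Q\<^esub> a \<odot>\<^bsub>?Q\<^esub> Y"
      by (simp only: add smult smult_r_distr[OF scalars] smult_closed[OF scalars] sum_closed)
  qed
  moreover have "rat_algebra_axioms ?Q"
  proof (rule rat_algebra_axioms.intro)
    fix c X Y assume "X \<in> carrier ?Q" "Y \<in> carrier ?Q"
    then obtain x y where x: "x \<in> carrier A" "X = I +> x" "y \<in> carrier A" "Y = I +> y"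
      using rep by metis
    then show "(c \<odot>\<^bsub>?Q\<^esub> X) \<otimes>\<^bsub>?Q\<^esub> Y = c \<odot>\<^bsub>?Q\<^esub> (X \<otimes>\<^bsub>?Q\<^esub> Y)"
      by (simp only: mult smult smult_mult_left smult_closed[OF scalars] prod_closed)
    from x show "X \<otimes>\<^bsub>?Q\<^esub> (c \<odot>\<^bsub>?Q\<^esub> Y) = c \<odot>\<^bsub>?Q\<^esub> (X \<otimes>\<^bsub>?Q\<^esub> Y)"
      by (simp only: mult smult smult_mult_right smult_closed[OF scalars] prod_closed)
  qed
  ultimately show ?thesis
    by (rule rat_algebra.intro[OF ring])
qed

end

lemma first_isomorphism:
  assumes "rat_algebra A" "rat_algebra C"
    and hom: "\<phi> \<in> ring_hom A C" and surj: "\<phi> ` carrier A = carrier C"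
    and smult: "\<And>c x. x \<in> carrier A \<Longrightarrow> \<phi> (c \<odot>\<^bsub>A\<^esub> x) = c \<odot>\<^bsub>C\<^esub> \<phi> x"
  shows "ideal (a_kernel A C \<phi>) A"
    and "rat_algebra_isomorphic C (quotient_algebra A (a_kernel A C \<phi>))"
proof -
  interpret A: rat_algebra A by fact
  interpret C: rat_algebra C by fact
  interpret ring_hom_ring A C \<phi>
    using assms(1,2)[THEN rat_algebra.axioms(1)] hom by (rule ring_hom_ringI2)
  let ?I = "a_kernel A C \<phi>"
  let ?Q = "quotient_algebra A ?I"
  show ideal: "ideal ?I A" by (rule kernel_is_ideal)
  \<comment> \<open>The induced isomorphism runs from the quotient to \<open>C\<close>; the required
    one is its inverse.\<close>
  define \<psi> where "\<psi> = inv_into (carrier (A Quot ?I)) (\<lambda>X. the_elem (\<phi> ` X))"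
  have "\<psi> \<in> ring_iso C (A Quot ?I)"
    unfolding \<psi>_def using surj
    by (intro ring_iso_set_sym ideal.quotient_is_ring ideal FactRing_iso_set)
  then have iso: "\<psi> \<in> ring_iso C ?Q"
    by (simp add: ring_iso_def ring_hom_def)
  \<comment> \<open>As \<open>\<phi>\<close> is surjective, this formula determines
    \<open>\<psi>\<close> on all of \<open>C\<close> and reduces compatibility with scalars to
    \<open>smult_quotient\<close>.\<close>
  have \<psi>: "\<psi> (\<phi> a) = ?I +>\<^bsub>A\<^esub> a" if "a \<in> carrier A" for a
    unfolding \<psi>_def
  proof (rule inv_into_f_eq)
    show "inj_on (\<lambda>X. the_elem (\<phi> ` X)) (carrier (A Quot ?I))"
      by (rule inj_onI) (rule the_elem_inj)
    show "?I +>\<^bsub>A\<^esub> a \<in> carrier (A Quot ?I)"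
      using that by (auto simp: FactRing_def A_RCOSETS_def')
    show "the_elem (\<phi> ` (?I +>\<^bsub>A\<^esub> a)) = \<phi> a"
      using that by (rule the_elem_simp)
  qed
  have "\<psi> (c \<odot>\<^bsub>C\<^esub> x) = c \<odot>\<^bsub>?Q\<^esub> \<psi> x" if x: "x \<in> carrier C" for c x
  proof -
    obtain a where a: "a \<in> carrier A" "x = \<phi> a"
      using x surj by blast
    have "c \<odot>\<^bsub>A\<^esub> a \<in> carrier A"
      using a(1) by simp
    then show ?thesis
      using a \<psi> by (simp add: smult[symmetric] A.smult_quotient[OF ideal])
  qed
  with iso show "rat_algebra_isomorphic C ?Q"
    using assms(2) A.rat_algebra_quotient[OF ideal]
    by (auto simp: rat_algebra_isomorphic_def)
qed


section \<open>Shuffles and packed words\<close>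

lemma Sh_Nil_right [simp]: "Sh xs [] = {#xs#}"
  by (cases xs) simp_all

text \<open>Stated without the second argument so that it also rewrites the eta-contracted
  \<open>Sh []\<close> inside multiset sums.\<close>

lemma Sh_Nil_left: "Sh [] = (\<lambda>ys. {#ys#})"
  by (rule ext) simp

text \<open>Interleaving depends only on positions and never compares letters, so it commutes with
  every relabelling.\<close>

lemma map_Sh: "image_mset (map f) (Sh xs ys) = Sh (map f xs) (map f ys)"
proof (induction xs ys rule: Sh.induct)
  case (3 x xs y ys)
  have "image_mset (map f) (image_mset ((#) z) M) = image_mset ((#) (f z)) (image_mset (map f) M)"
    for z M
    by (simp add: multiset.map_comp comp_def)
  with 3 show ?case by simp
qed simp_all

text \<open>Both sides are split by whether the first letter of the result comes from
  \<open>xs\<close>, \<open>ys\<close> or \<open>zs\<close>; removing it lowers the total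
  length.\<close>

lemma Sh_assoc: "(\<Sum>u\<in>#Sh xs ys. Sh u zs) = (\<Sum>u\<in>#Sh ys zs. Sh xs u)"
proof (induction "length xs + length ys + length zs" arbitrary: xs ys zs rule: less_induct)
  case less
  show ?case
  proof (cases "xs = [] \<or> ys = [] \<or> zs = []")
    case True
    then show ?thesis by (auto simp: Sh_Nil_left)
  next
    case False
    then obtain x xs' y ys' z zs' where eqs: "xs = x # xs'" "ys = y # ys'" "zs = z # zs'"
      by (metis neq_Nil_conv)
    have left: "(\<Sum>u\<in>#image_mset ((#) a) M. Sh u (z # zs')) =
        image_mset ((#) a) (\<Sum>u\<in>#M. Sh u (z # zs')) +
        image_mset ((#) z) (\<Sum>u\<in>#image_mset ((#) a) M. Sh u zs')" for a M
      by (induction M) simp_all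
    have right: "(\<Sum>u\<in>#image_mset ((#) a) M. Sh (x # xs') u) =
        image_mset ((#) x) (\<Sum>u\<in>#image_mset ((#) a) M. Sh xs' u) +
        image_mset ((#) a) (\<Sum>u\<in>#M. Sh (x # xs') u)" for a M
      by (induction M) simp_all
    have "(\<Sum>u\<in>#Sh xs ys. Sh u zs) =
        image_mset ((#) x) (\<Sum>u\<in>#Sh xs' ys. Sh u zs) +
        image_mset ((#) y) (\<Sum>u\<in>#Sh xs ys'. Sh u zs) +
        image_mset ((#) z) (\<Sum>u\<in>#Sh xs ys. Sh u zs')"
      unfolding eqs Sh.simps image_mset_union sum_mset.union left by (simp add: ac_simps)
    also have "\<dots> =
        image_mset ((#) x) (\<Sum>u\<in>#Sh ys zs. Sh xs' u) +
        image_mset ((#) y) (\<Sum>u\<in>#Sh ys' zs. Sh xs u) +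
        image_mset ((#) z) (\<Sum>u\<in>#Sh ys zs'. Sh xs u)"
      using less[of xs' ys zs] less[of xs ys' zs] less[of xs ys zs'] by (simp add: eqs)
    also have "\<dots> = (\<Sum>u\<in>#Sh ys zs. Sh xs u)"
      unfolding eqs Sh.simps image_mset_union sum_mset.union right by (simp add: ac_simps)
    finally show ?thesis .
  qed
qed

text \<open>Names the amount of the shift in \<open>shifted_Sh\<close>; the inserted 0 is its value
  on the empty word.\<close>

definition top_letter :: "nat list \<Rightarrow> nat" where
  "top_letter \<alpha> = Max (insert 0 (set \<alpha>))"

lemma shifted_Sh_top_letter: "shifted_Sh \<alpha> \<beta> = Sh \<alpha> (shift_word \<beta> (top_letter \<alpha>))"
  by (simp add: shifted_Sh_def top_letter_def)

lemma le_top_letter: "a \<in> set \<alpha> \<Longrightarrow> a \<le> top_letter \<alpha>"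
  by (simp add: top_letter_def)

lemma set_shift_word: "set (shift_word \<beta> k) = (\<lambda>b. b + k) ` set \<beta>"
  by (simp add: shift_word_def)

lemma set_in_Sh: "\<gamma> \<in># Sh \<alpha> \<beta> \<Longrightarrow> set \<gamma> = set \<alpha> \<union> set \<beta>"
  by (simp add: set_mset_Sh set_shuffles)

text \<open>All shifted shuffles of two words share one top letter, so a third word is always
  shifted by the same amount.\<close>

lemma top_letter_shifted_Sh:
  assumes "\<gamma> \<in># shifted_Sh \<alpha> \<beta>"
  shows "top_letter \<gamma> = top_letter \<alpha> + top_letter \<beta>"
proof -
  let ?k = "top_letter \<alpha>"
  have set: "set \<gamma> = set \<alpha> \<union> (\<lambda>b. b + ?k) ` set \<beta>"
    using assms by (simp add: shifted_Sh_top_letter set_in_Sh set_shift_word)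
  have top: "top_letter w \<in> insert 0 (set w)" for w
    unfolding top_letter_def by (rule Max_in) simp_all
  have "?k + top_letter \<beta> \<in> insert 0 (set \<gamma>)"
    using top[of \<alpha>] top[of \<beta>] set by (auto simp: add.commute)
  moreover have "a \<le> ?k + top_letter \<beta>" if "a \<in> insert 0 (set \<gamma>)" for a
    using that set le_top_letter[of _ \<alpha>] le_top_letter[of _ \<beta>] by (auto simp: trans_le_add1)
  ultimately show ?thesis
    unfolding top_letter_def[of \<gamma>] by (intro Max_eqI) simp_all
qed

text \<open>On the left \<delta> is always shifted by \<open>?k + ?l\<close>, so
  \<open>Sh_assoc\<close> applies. The common shift by \<open>?k\<close> of \<beta> and \<delta> is
  then pulled out of their shuffles.\<close>

lemma shifted_Sh_assoc:
  "(\<Sum>\<gamma>\<in>#shifted_Sh \<alpha> \<beta>. shifted_Sh \<gamma> \<delta>) = (\<Sum>\<gamma>\<in>#shifted_Sh \<beta> \<delta>. shifted_Sh \<alpha> \<gamma>)"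
proof -
  let ?k = "top_letter \<alpha>" and ?l = "top_letter \<beta>"
  have "(\<Sum>\<gamma>\<in>#shifted_Sh \<alpha> \<beta>. shifted_Sh \<gamma> \<delta>) =
      (\<Sum>\<gamma>\<in>#shifted_Sh \<alpha> \<beta>. Sh \<gamma> (shift_word \<delta> (?k + ?l)))"
    by (intro arg_cong[of _ _ sum_mset] image_mset_cong)
      (simp add: shifted_Sh_top_letter[of _ \<delta>] top_letter_shifted_Sh)
  also have "\<dots> = (\<Sum>\<gamma>\<in>#Sh (shift_word \<beta> ?k) (shift_word \<delta> (?k + ?l)). Sh \<alpha> \<gamma>)"
    by (simp add: shifted_Sh_top_letter Sh_assoc)
  also have "shift_word \<delta> (?k + ?l) = shift_word (shift_word \<delta> ?l) ?k"
    by (simp add: shift_word_def add_ac)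
  also have "Sh (shift_word \<beta> ?k) (shift_word (shift_word \<delta> ?l) ?k) =
      image_mset (\<lambda>\<gamma>. shift_word \<gamma> ?k) (shifted_Sh \<beta> \<delta>)"
    by (simp add: shifted_Sh_top_letter shift_word_def map_Sh)
  finally show ?thesis
    by (simp add: shifted_Sh_top_letter[of \<alpha>] multiset.map_comp comp_def)
qed

section \<open>Disjoint shifts and packed words\<close>

lemma shift_word_words: "\<beta> \<in> words \<Longrightarrow> shift_word \<beta> k \<in> words"
  by (auto simp: words_def set_shift_word)

text \<open>The letters of \<beta> are positive, so after the shift they all exceed the top letter
  of \<alpha>.\<close>

lemma disjoint_shift_word: "\<beta> \<in> words \<Longrightarrow> disjoint_words \<alpha> (shift_word \<beta> (top_letter \<alpha>))"
  using le_top_letter[of _ \<alpha>] by (force simp: disjoint_words_def words_def set_shift_word)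

text \<open>The rank \<open>?r\<close> is strictly increasing on the letters, so it takes
  \<open>card (set \<alpha>)\<close> distinct values in an interval of that size and fills
  it.\<close>

lemma set_pack: "set (pack \<alpha>) = {1..card (set \<alpha>)}"
proof (rule card_subset_eq)
  let ?r = "\<lambda>a. card {b \<in> set \<alpha>. b \<le> a}"
  have set: "set (pack \<alpha>) = ?r ` set \<alpha>"
    by (simp add: pack_def)
  show "set (pack \<alpha>) \<subseteq> {1..card (set \<alpha>)}"
    unfolding set by (auto simp: Suc_le_eq card_gt_0_iff intro: card_mono)
  have "?r a < ?r b" if "a < b" "b \<in> set \<alpha>" for a b
  proof (rule psubset_card_mono)
    show "{c \<in> set \<alpha>. c \<le> a} \<subset> {c \<in> set \<alpha>. c \<le> b}"
    proof
      show "{c \<in> set \<alpha>. c \<le> a} \<noteq> {c \<in> set \<alpha>. c \<le> b}"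
        using that by (metis (no_types, lifting) leD mem_Collect_eq order_refl)
    qed (use that in auto)
  qed simp
  then have "inj_on ?r (set \<alpha>)"
    by (metis (no_types, lifting) linorder_inj_onI' nat_neq_iff)
  then show "card (set (pack \<alpha>)) = card {1..card (set \<alpha>)}"
    unfolding set by (simp add: card_image)
qed simp

lemma pack_eq_self:
  assumes "set \<alpha> = {1..n}"
  shows "pack \<alpha> = \<alpha>"
proof -
  have "{b \<in> set \<alpha>. b \<le> a} = {1..a}" if "a \<in> set \<alpha>" for a
    using that assms by auto
  then show ?thesis
    by (simp add: pack_def map_idI)
qed

text \<open>Makes packedness a condition on the letter set alone, which is easily followed through
  shuffles. The empty word is the case \<open>n = 0\<close>.\<close>

lemma packed_words_iff: "\<alpha> \<in> packed_words \<longleftrightarrow> (\<exists>n. set \<alpha> = {1..n})"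
proof
  show "\<exists>n. set \<alpha> = {1..n}" if "\<alpha> \<in> packed_words"
    using that set_pack[of \<alpha>] by (auto simp: packed_words_def)
  show "\<alpha> \<in> packed_words" if "\<exists>n. set \<alpha> = {1..n}"
    using that pack_eq_self by (auto simp: packed_words_def words_def)
qed

lemma pack_packed: "pack \<alpha> \<in> packed_words"
  using set_pack by (auto simp: packed_words_iff)

lemma pack_pack: "pack (pack \<alpha>) = pack \<alpha>"
  using pack_packed[of \<alpha>] by (simp add: packed_words_def)

lemma packed_words_subset: "packed_words \<subseteq> words"
  by (auto simp: packed_words_def)

lemma top_letter_packed:
  assumes "set \<alpha> = {1..n}"
  shows "top_letter \<alpha> = n"
  unfolding top_letter_def assms by (rule Max_eqI) auto

lemma shifted_Sh_packed:
  assumes "\<alpha> \<in> packed_words" "\<beta> \<in> packed_words" "\<gamma> \<in># shifted_Sh \<alpha> \<beta>"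
  shows "\<gamma> \<in> packed_words"
proof -
  obtain m n where set: "set \<alpha> = {1..m}" "set \<beta> = {1..n}"
    using assms(1,2) by (auto simp: packed_words_iff)
  \<comment> \<open>The shifted letters of \<beta> continue the interval of \<alpha> without a
    gap.\<close>
  have "set \<gamma> = {1..m} \<union> (\<lambda>b. b + m) ` {1..n}"
    using assms(3) set
    by (simp add: shifted_Sh_top_letter set_in_Sh set_shift_word top_letter_packed[OF set(1)])
  also have "\<dots> = {1..m + n}"
    by (auto simp: image_add_atLeastAtMost' ac_simps)
  finally show ?thesis
    by (auto simp: packed_words_iff)
qed

lemma monoid_basis_WQSym: "monoid_basis packed_words [] shifted_Sh"
proof
  show "[] \<in> packed_words"
    by (auto simp: packed_words_iff intro: exI[of _ 0])
  show "shifted_Sh [] \<alpha> = {#\<alpha>#}" "shifted_Sh \<alpha> [] = {#\<alpha>#}" for \<alpha>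
    by (simp_all add: shifted_Sh_def shift_word_def)
  show "set_mset (shifted_Sh \<alpha> \<beta>) \<subseteq> packed_words"
    if "\<alpha> \<in> packed_words" "\<beta> \<in> packed_words" for \<alpha> \<beta>
    using that shifted_Sh_packed by blast
qed (rule shifted_Sh_assoc)


section \<open>The shuffle algebra as a quotient\<close>

lemma st_class_eq:
  assumes "shuffle_compatible_on_words st" "\<alpha> \<in> words" "\<beta> \<in> words" "pack \<alpha> = pack \<beta>"
    and "length \<alpha> = length \<beta>"
  shows "st_class st \<alpha> = st_class st \<beta>"
proof -
  have "st \<alpha> = st \<beta>"
    using assms(1-4) unfolding shuffle_compatible_on_words_def by blast
  with assms(5) show ?thesis
    by (simp add: st_class_def)
qed

text \<open>A word and its packing have the same length and statistic, hence the same class. This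
  gives surjectivity on basis elements.\<close>

lemma st_class_packed:
  assumes "shuffle_compatible_on_words st"
  shows "st_class st ` packed_words = st_class st ` words"
proof
  show "st_class st ` words \<subseteq> st_class st ` packed_words"
  proof (intro image_subsetI)
    fix \<alpha> assume "\<alpha> \<in> words"
    moreover have "length \<alpha> = length (pack \<alpha>)"
      by (simp add: pack_def)
    ultimately have "st_class st \<alpha> = st_class st (pack \<alpha>)"
      using assms pack_packed packed_words_subset
      by (intro st_class_eq) (auto simp: pack_pack)
    then show "st_class st \<alpha> \<in> st_class st ` packed_words"
      using pack_packed by blast
  qed
qed (use packed_words_subset in blast)

lemma class_product_shifted_Sh:
  assumes "shuffle_compatible_on_words st" "\<alpha> \<in> words" "\<beta> \<in> words"
  shows "class_product st (st_class st \<alpha>) (st_class st \<beta>) =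
    image_mset (st_class st) (shifted_Sh \<alpha> \<beta>)"
proof -
  let ?\<beta> = "shift_word \<beta> (top_letter \<alpha>)"
  \<comment> \<open>Shifting changes neither the packing nor the length, so \<open>?\<beta>\<close>
    may replace \<beta> as a representative disjoint from \<alpha>.\<close>
  have "st_class st \<beta> = st_class st ?\<beta>"
    using assms by (intro st_class_eq)
      (simp_all add: shift_word_words pack_shift_word, simp add: shift_word_def)
  then show ?thesis
    using assms
    by (simp add: class_product_eq shift_word_words disjoint_shift_word shifted_Sh_top_letter)
qed

theorem proposition3p4:
  fixes st :: "nat list \<Rightarrow> 's"
  assumes "shuffle_compatible_on_words st"
  shows "\<exists>I. ideal I WQSym_dual \<and>
           rat_algebra_isomorphic (shuffle_algebra st) (quotient_algebra WQSym_dual I)"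
proof -
  interpret W: monoid_basis packed_words "[]" shifted_Sh
    by (rule monoid_basis_WQSym)
  let ?q = "st_class st"
  let ?I = "a_kernel WQSym_dual (shuffle_algebra st) (map_basis ?q)"
  have product: "class_product st (?q \<alpha>) (?q \<beta>) = image_mset ?q (shifted_Sh \<alpha> \<beta>)"
    if "\<alpha> \<in> packed_words" "\<beta> \<in> packed_words" for \<alpha> \<beta>
    using that packed_words_subset by (intro class_product_shifted_Sh assms) auto
  note image = st_class_packed[OF assms]
  \<comment> \<open>The laws for classes are images of those for packed words; \<open>image\<close>
    identifies the images of the packed words with the full set of classes.\<close>
  interpret S: monoid_basis "?q ` words" "?q []" "class_product st"
    using W.monoid_basis_image[of "class_product st" ?q] product by (simp add: image)
  have "rat_algebra WQSym_dual" "rat_algebra (shuffle_algebra st)"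
    unfolding WQSym_dual_def shuffle_algebra_def by (rule W.rat_algebra S.rat_algebra)+
  moreover have "map_basis ?q \<in> ring_hom WQSym_dual (shuffle_algebra st)"
    unfolding WQSym_dual_def shuffle_algebra_def
    using keys_map_basis[of _ packed_words ?q] product
    by (intro ring_hom_memI) (simp_all add: map_basis_add image map_basis_mult[of _ packed_words])
  moreover have "map_basis ?q ` carrier WQSym_dual = carrier (shuffle_algebra st)"
    by (simp add: WQSym_dual_def shuffle_algebra_def map_basis_image image)
  moreover have "map_basis ?q (c \<odot>\<^bsub>WQSym_dual\<^esub> x) = c \<odot>\<^bsub>shuffle_algebra st\<^esub> map_basis ?q x" for c x
    by (simp add: WQSym_dual_def shuffle_algebra_def map_basis_scale)
  ultimately have "ideal ?I WQSym_dual"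
    and "rat_algebra_isomorphic (shuffle_algebra st) (quotient_algebra WQSym_dual ?I)"
    by (rule first_isomorphism)+
  then show ?thesis
    by (intro exI conjI)
qed

end
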